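(* Let $G$ be a complete multipartite graph having exactly $k$ parts of odd cardinality. Then the cordial edge deficiency of $G$ is $$\mathrm{ced}(G)=\max\left\{0,\left\lfloor \tfrac{k}{2}\right\rfloor-1\right\}.$$
   Context: Graphs are finite and may have multiple edges but no loops. A binary labeling of a graph $G$ is a map $f:V(G)\to\{0,1\}$. Two real numbers $x,y$ are roughly equal if $|x-y|\le 1$. A binary labeling $f$ is friendly if $|f^{-1}(0)|$ and $|f^{-1}(1)|$ are roughly equal. A binary labeling $f$ induces an edge labeling $f_e:E(G)\to\{0,1\}$ by $f_e(uv)=f(u)+f(v) \pmod 2$. A friendly labeling $f$ is cordial if $|f_e^{-1}(0)|$ and $|f_e^{-1}(1)|$ are roughly equal; a graph is cordial if it has a cordial labeling. The cordial edge deficiency $\mathrm{ced}(G)$ is the minimum, taken over all friendly labelings $f$ of $G$, of the number of edges that must be added to $G$ (between pairs of existing distinct vertices, multiple edges allowed) so that $f$ becomes a cordial labeling of the augmented graph. A complete multipartite graph is a graph whose vertex set is partitioned into nonempty parts, with two vertices adjacent (by a single edge) if and only if they lie in different parts. *)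

theory Defs
  imports Complex_Main "HOL-Library.Multiset" "HOL-Library.Extended_Nat"
    "HOL-Library.Disjoint_Sets" "HOL-Library.FuncSet"
begin

text \<open>
  Edges form a multiset of two-element vertex sets, so multiple edges are allowed and loops are not.
\<close>

record 'a multigraph =
  verts :: "'a set"
  edges :: "'a set multiset"

definition vertex_pairs :: "'a multigraph \<Rightarrow> 'a set set" where
  "vertex_pairs G = {e. e \<subseteq> verts G \<and> card e = 2}"

definition wf_multigraph :: "'a multigraph \<Rightarrow> bool" where
  "wf_multigraph G \<longleftrightarrow> finite (verts G) \<and> set_mset (edges G) \<subseteq> vertex_pairs G"

definition add_edges :: "'a multigraph \<Rightarrow> 'a set multiset \<Rightarrow> 'a multigraph" where
  "add_edges G A = G\<lparr>edges := edges G + A\<rparr>"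

definition roughly_equal :: "real \<Rightarrow> real \<Rightarrow> bool" where
  "roughly_equal x y \<longleftrightarrow> \<bar>x - y\<bar> \<le> 1"

definition binary_labeling :: "'a multigraph \<Rightarrow> ('a \<Rightarrow> nat) \<Rightarrow> bool" where
  "binary_labeling G f \<longleftrightarrow> f \<in> verts G \<rightarrow> {0, 1}"

text \<open>On an edge \<open>{u, v}\<close> with \<open>u \<noteq> v\<close> this is \<open>(f u + f v) mod 2\<close>.\<close>

definition edge_label :: "('a \<Rightarrow> nat) \<Rightarrow> 'a set \<Rightarrow> nat" where
  "edge_label f e = (\<Sum>v\<in>e. f v) mod 2"

definition friendly :: "'a multigraph \<Rightarrow> ('a \<Rightarrow> nat) \<Rightarrow> bool" where
  "friendly G f \<longleftrightarrow> binary_labeling G f \<and>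
     roughly_equal (card {v \<in> verts G. f v = 0}) (card {v \<in> verts G. f v = 1})"

definition cordial_labeling :: "'a multigraph \<Rightarrow> ('a \<Rightarrow> nat) \<Rightarrow> bool" where
  "cordial_labeling G f \<longleftrightarrow> friendly G f \<and>
     roughly_equal (size {#e \<in># edges G. edge_label f e = 0#})
       (size {#e \<in># edges G. edge_label f e = 1#})"

text \<open>
  The values are extended naturals because some labelings cannot be repaired: on two vertices a
  friendly labeling gives label 1 to every possible edge, and \<open>Inf {} = \<infinity>\<close> records this.
  The infimum of a nonempty set of extended naturals is attained, so it is a minimum.
\<close>

definition edges_needed :: "'a multigraph \<Rightarrow> ('a \<Rightarrow> nat) \<Rightarrow> enat" where
  "edges_needed G f =
     Inf {enat (size A) | A. set_mset A \<subseteq> vertex_pairs G \<and> cordial_labeling (add_edges G A) f}"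

definition ced :: "'a multigraph \<Rightarrow> enat" where
  "ced G = (INF f\<in>{f. friendly G f}. edges_needed G f)"

definition complete_multipartite :: "'a multigraph \<Rightarrow> 'a set set \<Rightarrow> bool" where
  "complete_multipartite G P \<longleftrightarrow> wf_multigraph G \<and> partition_on (verts G) P \<and>
     edges G = mset_set {{u, v} | u v. \<exists>X\<in>P. \<exists>Y\<in>P. X \<noteq> Y \<and> u \<in> X \<and> v \<in> Y}"

end

theory Submission
  imports Defs
begin

text \<open>
  Give a vertex \<open>v\<close> the sign \<open>1 - 2 f v\<close>, and let \<open>s X\<close> be the sum of the signs over \<open>X\<close>. The sign
  of an edge is the product of the signs of its ends, so the number of edges labeled 1 minus the
  number labeled 0 is \<open>((\<Sum>X\<in>P. (s X)\<^sup>2) - (s V)\<^sup>2) / 2\<close>. A friendly labeling has \<open>\<bar>s V\<bar> \<le> 1\<close>, and \<open>s X\<close>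
  is odd on odd parts; hence this difference is at least \<open>k div 2\<close>, with equality when every
  \<open>s X\<close> is in \<open>{-1, 0, 1}\<close>. Each added edge changes the difference by one.
\<close>

section \<open>Signs of vertex sets and the excess of an edge multiset\<close>

definition sign_sum :: "('a \<Rightarrow> nat) \<Rightarrow> 'a set \<Rightarrow> int" where
  "sign_sum f X = (\<Sum>v\<in>X. 1 - 2 * int (f v))"

definition edge_excess :: "('a \<Rightarrow> nat) \<Rightarrow> 'a set multiset \<Rightarrow> int" where
  "edge_excess f A = int (size {#e \<in># A. edge_label f e = 1#}) - int (size {#e \<in># A. edge_label f e = 0#})"

lemma edge_excess_add: "edge_excess f (A + B) = edge_excess f A + edge_excess f B"
  by (simp add: edge_excess_def)

lemma edge_excess_add_mset:
  "edge_excess f (add_mset e A) = edge_excess f A + (if edge_label f e = 0 then - 1 else 1)"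
proof -
  have "edge_label f e = 0 \<or> edge_label f e = 1"
    by (auto simp: edge_label_def)
  then show ?thesis
    by (auto simp: edge_excess_def)
qed

lemma abs_edge_excess_le_size: "\<bar>edge_excess f A\<bar> \<le> int (size A)"
proof (induction A)
  case empty
  then show ?case by (simp add: edge_excess_def)
next
  case (add e A)
  then show ?case by (auto simp: edge_excess_add_mset)
qed

lemma edge_excess_mset_set:
  assumes "finite E"
  shows "edge_excess f (mset_set E) = (\<Sum>e\<in>E. if edge_label f e = 0 then - 1 else 1)"
  using assms
proof (induction E rule: finite_induct)
  case empty
  then show ?case by (simp add: edge_excess_def)
next
  case (insert e E)
  then show ?case by (simp add: edge_excess_add_mset)
qed

text \<open>Distinct ends matter: for \<open>u = v\<close> the set collapses to a singleton and the
  sum counts \<open>f u\<close> only once.\<close>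

lemma edge_label_pair_eq_0_iff:
  assumes "f u \<in> {0, 1}" "f v \<in> {0, 1}" "u \<noteq> v"
  shows "edge_label f {u, v} = 0 \<longleftrightarrow> f u = f v"
  using assms by (auto simp: edge_label_def)

lemma sign_sum_eq_card_diff:
  assumes "finite X" "f \<in> X \<rightarrow> {0, 1}"
  shows "sign_sum f X = int (card {v \<in> X. f v = 0}) - int (card {v \<in> X. f v = 1})"
proof -
  have "sign_sum f X = (\<Sum>v\<in>X. of_bool (f v = 0) - of_bool (f v = 1))"
    unfolding sign_sum_def using assms(2) by (intro sum.cong refl) (drule (1) Pi_mem, auto)
  also have "\<dots> = int (card {v \<in> X. f v = 0}) - int (card {v \<in> X. f v = 1})"
    using assms(1) by (simp add: sum_subtractf Int_def)
  finally show ?thesis .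
qed

text \<open>Every summand is odd whatever \<open>f\<close> is, so only the number of summands
  decides the parity.\<close>

lemma odd_sign_sum_iff:
  assumes "finite X"
  shows "odd (sign_sum f X) \<longleftrightarrow> odd (card X)"
  by (simp add: sign_sum_def sum_subtractf flip: sum_distrib_left)

lemma friendly_iff_sign_sum:
  assumes "finite (verts G)"
  shows "friendly G f \<longleftrightarrow> f \<in> verts G \<rightarrow> {0, 1} \<and> \<bar>sign_sum f (verts G)\<bar> \<le> 1"
proof (cases "f \<in> verts G \<rightarrow> {0, 1}")
  case True
  have "roughly_equal (real m) (real n) \<longleftrightarrow> \<bar>int m - int n\<bar> \<le> 1" for m n
    unfolding roughly_equal_def by linarith
  with True show ?thesis
    by (simp add: friendly_def binary_labeling_def sign_sum_eq_card_diff[OF assms True])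
next
  case False
  then show ?thesis by (auto simp: friendly_def binary_labeling_def)
qed

text \<open>Adding edges keeps the vertex set, hence friendliness, and the excess is additive. The
  repair of a labeling thus becomes a question about one integer.\<close>

lemma cordial_labeling_add_edges_iff:
  "cordial_labeling (add_edges G A) f \<longleftrightarrow>
     friendly G f \<and> \<bar>edge_excess f (edges G) + edge_excess f A\<bar> \<le> 1"
proof -
  have "roughly_equal (real m) (real n) \<longleftrightarrow> \<bar>int n - int m\<bar> \<le> 1" for m n
    unfolding roughly_equal_def by linarith
  moreover have "friendly (add_edges G A) f \<longleftrightarrow> friendly G f"
    by (simp add: friendly_def binary_labeling_def add_edges_def)
  ultimately show ?thesis
    unfolding cordial_labeling_def edge_excess_add[symmetric]
    by (simp add: edge_excess_def add_edges_def del: filter_union_mset size_union)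
qed

text \<open>Expand the square of the total sign sum over ordered pairs of vertices. Pairs inside a
  common part give the squares of the part sums; the remaining pairs run over every edge
  twice.\<close>

lemma edge_excess_complete_multipartite:
  assumes G: "complete_multipartite G P" and f: "f \<in> verts G \<rightarrow> {0, 1}"
  shows "2 * edge_excess f (edges G) = (\<Sum>X\<in>P. (sign_sum f X)\<^sup>2) - (sign_sum f (verts G))\<^sup>2"
proof -
  define V where "V = verts G"
  define s where "s v = 1 - 2 * int (f v)" for v
  define D where "D = {(u, v). \<exists>X\<in>P. \<exists>Y\<in>P. X \<noteq> Y \<and> u \<in> X \<and> v \<in> Y}"
  define E where "E = {{u, v} | u v. \<exists>X\<in>P. \<exists>Y\<in>P. X \<noteq> Y \<and> u \<in> X \<and> v \<in> Y}"
  define pair where "pair = (\<lambda>(u, v). {u, v :: 'a})"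
  have finV: "finite V" and part: "partition_on V P" and edges: "edges G = mset_set E"
    using G by (auto simp: complete_multipartite_def wf_multigraph_def V_def E_def)
  have V: "V = \<Union>P" and disj: "\<And>X Y. X \<in> P \<Longrightarrow> Y \<in> P \<Longrightarrow> X \<noteq> Y \<Longrightarrow> X \<inter> Y = {}"
    using part by (auto simp: partition_on_def disjoint_def)
  have finP: "finite P" and finX: "\<And>X. X \<in> P \<Longrightarrow> finite X"
    using finV V by (auto intro: finite_UnionD finite_subset)
  have D_sub: "D \<subseteq> V \<times> V"
    by (auto simp: D_def V)
  then have finD: "finite D"
    using finV by (meson finite_SigmaI finite_subset)
  have E: "E = pair ` D"
  proof -
    have "E = {{u, v} | u v. (u, v) \<in> D}"
      by (simp add: E_def D_def)
    also have "\<dots> = pair ` D"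
      unfolding pair_def by force
    finally show ?thesis .
  qed
  have D_sym: "(v, u) \<in> D" and D_neq: "u \<noteq> v" if "(u, v) \<in> D" for u v
    using that disj unfolding D_def by blast+
  \<comment> \<open>Disjointness of the parts enters here: a pair inside one part cannot also be
    witnessed as a pair across two parts.\<close>
  have same_part: "V \<times> V - D = (\<Union>X\<in>P. X \<times> X)"
  proof (intro equalityI subsetI)
    fix p assume "p \<in> V \<times> V - D"
    then show "p \<in> (\<Union>X\<in>P. X \<times> X)"
      unfolding D_def V by blast
  next
    fix p assume "p \<in> (\<Union>X\<in>P. X \<times> X)"
    then obtain X u v where p: "p = (u, v)" and X: "X \<in> P" "u \<in> X" "v \<in> X"
      by blast
    have "Y = X" if "Y \<in> P" "u \<in> Y \<or> v \<in> Y" for Y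
      using disj[OF that(1) X(1)] that(2) X by blast
    with p X show "p \<in> V \<times> V - D"
      unfolding D_def V by blast
  qed
  have "(sign_sum f V)\<^sup>2 = (\<Sum>(u, v)\<in>V \<times> V. s u * s v)"
    by (simp add: sign_sum_def s_def power2_eq_square sum_product sum.cartesian_product)
  also have "\<dots> = (\<Sum>(u, v)\<in>V \<times> V - D. s u * s v) + (\<Sum>(u, v)\<in>D. s u * s v)"
    using D_sub finV by (intro sum.subset_diff) auto
  also have "(\<Sum>(u, v)\<in>V \<times> V - D. s u * s v) = (\<Sum>X\<in>P. \<Sum>(u, v)\<in>X \<times> X. s u * s v)"
    unfolding same_part using finP finX disj by (intro sum.UNION_disjoint) blast+
  also have "\<dots> = (\<Sum>X\<in>P. (sign_sum f X)\<^sup>2)"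
    by (simp add: sign_sum_def s_def power2_eq_square sum_product sum.cartesian_product)
  \<comment> \<open>Group the ordered pairs by their underlying edge; each fibre consists of the two
    orientations, whose equal products add up to 2 on label 0 and -2 on label 1.\<close>
  also have "(\<Sum>(u, v)\<in>D. s u * s v) = (\<Sum>e\<in>E. \<Sum>(u, v)\<in>{p \<in> D. pair p = e}. s u * s v)"
    unfolding E by (rule sum.image_gen[OF finD])
  also have "\<dots> = (\<Sum>e\<in>E. - 2 * (if edge_label f e = 0 then - 1 else 1))"
  proof (rule sum.cong)
    fix e assume "e \<in> E"
    then obtain u v where uv: "(u, v) \<in> D" and e: "e = {u, v}"
      by (auto simp: E pair_def)
    have fib: "{p \<in> D. pair p = e} = {(u, v), (v, u)}"
      using uv D_sym by (auto simp: pair_def e doubleton_eq_iff)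
    have "f u \<in> {0, 1}" "f v \<in> {0, 1}"
      using uv D_sub f by (auto simp: V_def)
    then show "(\<Sum>(u, v)\<in>{p \<in> D. pair p = e}. s u * s v)
      = - 2 * (if edge_label f e = 0 then - 1 else 1)"
      using D_neq[OF uv] unfolding fib
      by (auto simp: e edge_label_pair_eq_0_iff s_def)
  qed simp
  also have "\<dots> = - 2 * edge_excess f (edges G)"
    using finD unfolding edges sum_distrib_left[symmetric]
    by (subst edge_excess_mset_set) (simp_all add: E)
  finally show ?thesis
    by (simp add: V_def)
qed

lemma abs_le_1_square:
  fixes x :: int
  assumes "\<bar>x\<bar> \<le> 1"
  shows "x\<^sup>2 = of_bool (odd x)"
proof -
  have "x \<in> {- 1, 0, 1}" using assms by auto
  then show ?thesis by auto
qed

section \<open>Bounds on the excess of friendly labelings\<close>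

context
  fixes G :: "'a multigraph" and P :: "'a set set"
  assumes G: "complete_multipartite G P"
begin

lemma finite_verts: "finite (verts G)"
  using G by (simp add: complete_multipartite_def wf_multigraph_def)

lemma partition_verts: "partition_on (verts G) P"
  using G by (simp add: complete_multipartite_def)

lemma finite_parts: "finite P"
  using finite_verts partition_verts by (rule finite_elements)

lemma finite_part: "X \<in> P \<Longrightarrow> finite X"
  using finite_verts partition_verts by (auto simp: partition_on_def intro: finite_subset)

lemma sign_sum_verts: "sign_sum f (verts G) = (\<Sum>X\<in>P. sign_sum f X)"
  unfolding sign_sum_def
  using sum.Union_disjoint[of P "\<lambda>v. 1 - 2 * int (f v)"] finite_part partition_verts
  by (auto simp: partition_on_def disjoint_def)

text \<open>The total has the parity of the number of odd part sums, and an integer of absolute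
  value at most 1 is determined up to sign by its parity.\<close>

lemma friendly_sign_sum_verts_square:
  assumes "friendly G f"
  shows "(sign_sum f (verts G))\<^sup>2 = int (card {X \<in> P. odd (card X)} mod 2)"
proof -
  have "{X \<in> P. odd (sign_sum f X)} = {X \<in> P. odd (card X)}"
    using finite_part odd_sign_sum_iff by blast
  then have "odd (sign_sum f (verts G)) \<longleftrightarrow> odd (card {X \<in> P. odd (card X)})"
    using even_sum_iff[OF finite_parts, of "sign_sum f"] by (simp add: sign_sum_verts)
  then show ?thesis
    using assms by (simp add: friendly_iff_sign_sum[OF finite_verts] abs_le_1_square mod_2_eq_odd)
qed

lemma sum_of_bool_odd_parts: "(\<Sum>X\<in>P. of_bool (odd (card X))) = int (card {X \<in> P. odd (card X)})"
  using finite_parts by (simp add: Int_def)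

text \<open>An odd part sum has square at least 1. With \<open>k\<close> odd parts, twice the excess
  is therefore at least \<open>k - k mod 2\<close>, which is \<open>2 * (k div 2)\<close>.\<close>

lemma edge_excess_ge:
  assumes "friendly G f"
  shows "int (card {X \<in> P. odd (card X)} div 2) \<le> edge_excess f (edges G)"
proof -
  have "of_bool (odd (card X)) \<le> (sign_sum f X)\<^sup>2" if "X \<in> P" for X
    using odd_sign_sum_iff[OF finite_part[OF that], of f]
    by (cases "sign_sum f X = 0") (auto simp: of_bool_def int_one_le_iff_zero_less)
  then have "int (card {X \<in> P. odd (card X)}) \<le> (\<Sum>X\<in>P. (sign_sum f X)\<^sup>2)"
    unfolding sum_of_bool_odd_parts[symmetric] by (rule sum_mono)
  moreover have "f \<in> verts G \<rightarrow> {0, 1}"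
    using assms by (simp add: friendly_def binary_labeling_def)
  ultimately show ?thesis
    using edge_excess_complete_multipartite[OF G, of f] friendly_sign_sum_verts_square[OF assms]
    by linarith
qed

lemma edge_excess_eq:
  assumes "friendly G f" and "\<And>X. X \<in> P \<Longrightarrow> \<bar>sign_sum f X\<bar> \<le> 1"
  shows "edge_excess f (edges G) = int (card {X \<in> P. odd (card X)} div 2)"
proof -
  have "(\<Sum>X\<in>P. (sign_sum f X)\<^sup>2) = (\<Sum>X\<in>P. of_bool (odd (card X)))"
    using assms(2) finite_part by (intro sum.cong) (auto simp: abs_le_1_square odd_sign_sum_iff)
  moreover have "f \<in> verts G \<rightarrow> {0, 1}"
    using assms by (simp add: friendly_def binary_labeling_def)
  ultimately show ?thesis
    using edge_excess_complete_multipartite[OF G, of f] friendly_sign_sum_verts_square[OF assms(1)]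
    unfolding sum_of_bool_odd_parts by linarith
qed

end

section \<open>A friendly labeling that is balanced on every part\<close>

lemma exists_labeling_sign_sum:
  assumes "finite X" "m \<le> card X"
  shows "\<exists>f \<in> X \<rightarrow> {0, 1}. sign_sum f X = int (card X) - 2 * int m"
proof -
  obtain Y where Y: "Y \<subseteq> X" "card Y = m"
    using obtain_subset_with_card_n[OF assms(2)] by blast
  then have "sign_sum (of_bool \<circ> (\<lambda>v. v \<in> Y)) X = int (card X) - 2 * int m"
    using assms(1) by (simp add: sign_sum_def sum_subtractf Int_absorb1 flip: sum_distrib_left)
  then show ?thesis
    by (intro bexI[of _ "of_bool \<circ> (\<lambda>v. v \<in> Y)"]) auto
qed

text \<open>Add the parts one at a time. An even part can get sum 0; an odd part can get 1 or -1,
  and the sign is chosen against the running total.\<close>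

lemma exists_balanced_labeling:
  assumes "finite P" "\<And>X. X \<in> P \<Longrightarrow> finite X" "disjoint P"
  shows "\<exists>f \<in> \<Union>P \<rightarrow> {0, 1}. \<bar>sign_sum f (\<Union>P)\<bar> \<le> 1 \<and> (\<forall>X\<in>P. \<bar>sign_sum f X\<bar> \<le> 1)"
  using assms
proof (induction P rule: finite_induct)
  case empty
  then show ?case by (simp add: sign_sum_def)
next
  case (insert X P)
  have "disjoint P"
    using insert.prems(2) by (auto simp: disjoint_def)
  then obtain f where f: "f \<in> \<Union>P \<rightarrow> {0, 1}" "\<bar>sign_sum f (\<Union>P)\<bar> \<le> 1" "\<forall>Y\<in>P. \<bar>sign_sum f Y\<bar> \<le> 1"
    using insert.IH insert.prems(1) by auto
  define S where "S = sign_sum f (\<Union>P)"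
  \<comment> \<open>\<open>m\<close> is the number of vertices of \<open>X\<close> labeled 1. For
    odd \<open>card X\<close>, rounding up gives sum -1, used when \<open>S\<close> is positive, and
    rounding down gives 1, used when \<open>S\<close> is 0 or -1.\<close>
  define m where "m = (if S > 0 then (card X + 1) div 2 else card X div 2)"
  have "m \<le> card X"
    by (auto simp: m_def)
  then obtain g where g: "g \<in> X \<rightarrow> {0, 1}" "sign_sum g X = int (card X) - 2 * int m"
    using exists_labeling_sign_sum insert.prems(1) by blast
  have gX: "\<bar>sign_sum g X\<bar> \<le> 1" "\<bar>sign_sum g X + S\<bar> \<le> 1"
    using f(2) unfolding g(2) S_def[symmetric]
    by (cases "even (card X)"; auto simp: m_def elim!: evenE oddE)+
  define h where "h v = (if v \<in> X then g v else f v)" for v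
  \<comment> \<open>Here \<open>X \<notin> P\<close> guarantees that \<open>X\<close> differs from
    \<open>Y\<close>.\<close>
  have disj: "X \<inter> Y = {}" if "Y \<in> P" for Y
    using insert.prems(2) insert.hyps(2) that by (force simp: disjoint_def)
  have hX: "sign_sum h X = sign_sum g X"
    by (simp add: sign_sum_def h_def)
  have hf: "sign_sum h Y = sign_sum f Y" if "X \<inter> Y = {}" for Y
    unfolding sign_sum_def h_def using that by (intro sum.cong) auto
  have "sign_sum h (\<Union>(insert X P)) = sign_sum h X + sign_sum h (\<Union>P)"
    unfolding sign_sum_def Union_insert
    using insert.hyps(1) insert.prems(1) disj by (intro sum.union_disjoint) auto
  also have "\<dots> = sign_sum g X + S"
    using disj by (simp add: hX hf S_def Int_Union)
  finally have "\<bar>sign_sum h (\<Union>(insert X P))\<bar> \<le> 1"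
    using gX(2) by simp
  moreover have "h \<in> \<Union>(insert X P) \<rightarrow> {0, 1}"
    using f(1) g(1) unfolding h_def Pi_iff by auto
  moreover have "\<forall>Y\<in>insert X P. \<bar>sign_sum h Y\<bar> \<le> 1"
    using f(3) gX(1) disj by (auto simp: hX hf)
  ultimately show ?case by blast
qed

section \<open>Supply of edges that lower the excess\<close>

lemma friendly_exists_label_0_edge:
  assumes "finite (verts G)" "friendly G f" "card (verts G) \<ge> 3"
  shows "\<exists>e\<in>vertex_pairs G. edge_label f e = 0"
proof -
  have f: "f \<in> verts G \<rightarrow> {0, 1}"
    using assms(2) by (simp add: friendly_def binary_labeling_def)
  have "verts G = {v \<in> verts G. f v = 0} \<union> {v \<in> verts G. f v = 1}"
    using f by auto
  then have "card (verts G) \<le> card {v \<in> verts G. f v = 0} + card {v \<in> verts G. f v = 1}"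
    by (metis card_Un_le)
  \<comment> \<open>Pigeonhole: three vertices share two labels, and two vertices with the same
    label form a pair with edge label 0.\<close>
  then have "card {v \<in> verts G. f v = 0} \<ge> 2 \<or> card {v \<in> verts G. f v = 1} \<ge> 2"
    using assms(3) by linarith
  then obtain i where "card {v \<in> verts G. f v = i} \<ge> 2"
    by blast
  then obtain e where e: "e \<subseteq> {v \<in> verts G. f v = i}" "card e = 2"
    using obtain_subset_with_card_n by metis
  have "(\<Sum>v\<in>e. f v) = (\<Sum>v\<in>e. i)"
    using e(1) by (intro sum.cong) auto
  then have "edge_label f e = 0"
    using e(2) by (simp add: edge_label_def)
  moreover have "e \<in> vertex_pairs G"
    using e by (auto simp: vertex_pairs_def)
  ultimately show ?thesis by blast
qed

text \<open>Parts are nonempty, so each accounts for at least one vertex. This turns many odd parts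
  into enough vertices for a pair with edge label 0.\<close>

lemma card_odd_parts_le:
  assumes "finite V" "partition_on V P"
  shows "card {X \<in> P. odd (card X)} \<le> card V"
proof -
  have fin: "finite P" "\<And>X. X \<in> P \<Longrightarrow> finite X"
    using finite_elements[OF assms] assms by (auto simp: partition_on_def intro: finite_subset)
  have "card {X \<in> P. odd (card X)} \<le> card P"
    using fin(1) by (intro card_mono) auto
  also have "\<dots> = (\<Sum>X\<in>P. 1)"
    by simp
  also have "\<dots> \<le> (\<Sum>X\<in>P. card X)"
    using assms(2) fin(2) by (intro sum_mono) (auto simp: partition_on_def Suc_le_eq card_gt_0_iff)
  also have "\<dots> = card V"
    using assms(2) fin(2) card_Union_disjoint[of P]
    by (auto simp: partition_on_def disjoint_def pairwise_def disjnt_def)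
  finally show ?thesis .
qed

lemma edge_excess_replicate_mset:
  "edge_label f e = 0 \<Longrightarrow> edge_excess f (replicate_mset n e) = - int n"
  by (induction n) (simp_all add: edge_excess_add_mset, simp add: edge_excess_def)

theorem theorem3:
  fixes G :: "'a multigraph" and P :: "'a set set" and k :: nat
  assumes "complete_multipartite G P"
    and "card {X \<in> P. odd (card X)} = k"
  shows "ced G = enat (nat (max 0 (\<lfloor>real k / 2\<rfloor> - 1)))"
proof -
  note G = assms(1) and k = assms(2)
  \<comment> \<open>Truncated subtraction on \<open>nat\<close> absorbs the maximum with 0.\<close>
  have rhs: "nat (max 0 (\<lfloor>real k / 2\<rfloor> - 1)) = k div 2 - 1"
    using floor_divide_of_nat_eq[of k 2, where ?'a = real] by simp
  \<comment> \<open>The excess starts at \<open>k div 2\<close> or more and must end at 1 or less,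
    while \<open>A\<close> can lower it by at most \<open>size A\<close>.\<close>
  have lower: "enat (k div 2 - 1) \<le> ced G"
    unfolding ced_def edges_needed_def
  proof (intro INF_greatest Inf_greatest, clarify)
    fix f A assume "friendly G f" "cordial_labeling (add_edges G A) f"
    then have "int (k div 2) \<le> edge_excess f (edges G)"
      and "\<bar>edge_excess f (edges G) + edge_excess f A\<bar> \<le> 1"
      using edge_excess_ge[OF G] k by (auto simp: cordial_labeling_add_edges_iff)
    with abs_edge_excess_le_size[of f A] show "enat (k div 2 - 1) \<le> enat (size A)"
      by auto
  qed
  have fin: "finite (verts G)" and part: "partition_on (verts G) P"
    using finite_verts[OF G] partition_verts[OF G] .
  obtain f where f: "friendly G f" "\<forall>X\<in>P. \<bar>sign_sum f X\<bar> \<le> 1"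
    using exists_balanced_labeling[of P] finite_parts[OF G] finite_part[OF G] part
    by (auto simp: friendly_iff_sign_sum[OF fin] partition_on_def)
  have excess: "edge_excess f (edges G) = int (k div 2)"
    using edge_excess_eq[OF G f(1)] f(2) k by blast
  \<comment> \<open>Stopping at excess 1 rather than 0 saves one edge. If \<open>k div 2\<close> is
    at most 1, nothing is added; otherwise one pair with label 0 is repeated, as multiple edges are
    allowed.\<close>
  obtain A where A: "set_mset A \<subseteq> vertex_pairs G" "size A = k div 2 - 1"
    "edge_excess f A = - int (k div 2 - 1)"
  proof (cases "k div 2 \<le> 1")
    case True
    then show ?thesis using that[of "{#}"] by (simp add: edge_excess_def)
  next
    case False
    \<comment> \<open>In this case \<open>k\<close> is at least 4, so there are at least 4
      vertices.\<close>
    then have "3 \<le> card (verts G)"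
      using card_odd_parts_le[OF fin part] k by linarith
    then obtain e where "e \<in> vertex_pairs G" "edge_label f e = 0"
      using friendly_exists_label_0_edge[OF fin f(1)] by blast
    then show ?thesis
      using that[of "replicate_mset (k div 2 - 1) e"]
      by (auto simp: edge_excess_replicate_mset)
  qed
  have "cordial_labeling (add_edges G A) f"
    using f(1) excess A(3) by (auto simp: cordial_labeling_add_edges_iff)
  then have "edges_needed G f \<le> enat (size A)"
    using A(1) unfolding edges_needed_def by (intro Inf_lower) auto
  then have "ced G \<le> enat (k div 2 - 1)"
    unfolding ced_def using f(1) A(2) by (auto intro: INF_lower2)
  with lower show ?thesis
    by (simp add: rhs)
qed

end
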